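(* Let $G$ be a connected graph with $n \geq 2$ vertices. If $n$ is even, then $cr(G) \leq 4n - 4$, and if $n$ is odd, then $cr(G) \leq 4n - 3$.
   Context: Graphs are simple, undirected and labelled. A bicoloration of a graph $G=(V,E)$ is a mapping $\beta:V\to\{-1,1\}$, and a bicolored graph on $G$ is a pair $B=(G,\beta)$. Two bicolored graphs on the same vertex set are equal if they have the same edge set and the same coloring. $N_G(a)$ denotes the open neighborhood of $a$. For $a\in V$, the local complement $G_a$ is the graph on $V$ obtained from $G$ by toggling adjacency between every pair of distinct vertices of $N_G(a)$ (all other adjacencies are unchanged). The coloring $\beta_a$ is given by $\beta_a(x)=-\beta(x)$ if $x\in N_G(a)$ and $\beta_a(x)=\beta(x)$ otherwise. The local inversion of $B$ at $a$ is $B_a=(G_a,\beta_a)$. For a string $w\in V^*$ (a finite sequence of vertices, with length $|w|$), $B_w$ is defined inductively by $B_\varepsilon=B$ for the empty string $\varepsilon$, and $B_{w'a}=(B_{w'})_a$. For $A\subseteq V$, $B^{A}$ denotes the bicolored graph with the same underlying graph $G$ in which the colors of exactly the vertices in $A$ are flipped (multiplied by $-1$). The color reversal number $cr(G)$ is the minimum $\ell$ such that for every bicoloration $\beta$ of $G$, with $B=(G,\beta)$, there exists a string $w\in V^*$ with $|w|\le \ell$ and $B_w=B^{V}$. An inequality $cr(G)\le N$ includes the assertion that such an $\ell$ exists. *)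

theory Defs
  imports
    "Graph_Theory.Digraph_Component"
    "HOL-Library.FuncSet"
    "HOL-Library.Extended_Nat"
begin

text \<open>
  A finite simple undirected graph is a \<^locale>\<open>pair_graph\<close>: an edge between \<open>x\<close> and \<open>y\<close>
  is the pair of arcs \<open>(x, y)\<close> and \<open>(y, x)\<close>.
\<close>

definition nbhd :: "'a pair_pre_digraph \<Rightarrow> 'a \<Rightarrow> 'a set" where
  "nbhd G a = {x. (a, x) \<in> parcs G}"

definition local_complement :: "'a pair_pre_digraph \<Rightarrow> 'a \<Rightarrow> 'a pair_pre_digraph" where
  "local_complement G a =
     \<lparr> pverts = pverts G,
       parcs = {(x, y). ((x, y) \<in> parcs G) \<noteq> (x \<in> nbhd G a \<and> y \<in> nbhd G a \<and> x \<noteq> y)} \<rparr>"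

text \<open>
  Colorings are extensional (\<open>undefined\<close> outside the vertex set), and recoloring never
  touches a non-vertex. Hence equality of pairs \<open>(G, \<beta>)\<close> in HOL is exactly
  equality of bicolored graphs: same vertices, same edges, same colors on the vertices.
\<close>

type_synonym 'a bigraph = "'a pair_pre_digraph \<times> ('a \<Rightarrow> int)"

definition bicolorations :: "'a pair_pre_digraph \<Rightarrow> ('a \<Rightarrow> int) set" where
  "bicolorations G = (pverts G \<rightarrow>\<^sub>E {-1, 1})"

definition flip_colors :: "'a set \<Rightarrow> ('a \<Rightarrow> int) \<Rightarrow> 'a \<Rightarrow> int" where
  "flip_colors A \<beta> = (\<lambda>x. if x \<in> A then - \<beta> x else \<beta> x)"

definition local_inversion :: "'a bigraph \<Rightarrow> 'a \<Rightarrow> 'a bigraph" where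
  "local_inversion B a =
     (local_complement (fst B) a, flip_colors (nbhd (fst B) a) (snd B))"

definition local_inversions :: "'a bigraph \<Rightarrow> 'a list \<Rightarrow> 'a bigraph" where
  "local_inversions B w = foldl local_inversion B w"

definition color_flip :: "'a bigraph \<Rightarrow> 'a set \<Rightarrow> 'a bigraph" where
  "color_flip B A = (fst B, flip_colors A (snd B))"

text \<open>
  The minimum is taken in \<^typ>\<open>enat\<close>, where the infimum of the empty set is \<open>\<infinity>\<close>. So a finite
  upper bound on \<open>cr G\<close> includes the assertion that a suitable \<open>l\<close> exists.
\<close>

definition cr :: "'a pair_pre_digraph \<Rightarrow> enat" where
  "cr G = Inf {enat l | l. \<forall>\<beta> \<in> bicolorations G. \<exists>w \<in> lists (pverts G).
     length w \<le> l \<and> local_inversions (G, \<beta>) w = color_flip (G, \<beta>) (pverts G)}"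

lemma local_inversions_Nil [simp]: "local_inversions B [] = B"
  by (simp add: local_inversions_def)

lemma local_inversions_snoc [simp]:
  "local_inversions B (w @ [a]) = local_inversion (local_inversions B w) a"
  by (simp add: local_inversions_def)

lemma pair_graph_local_complement:
  assumes "pair_graph G"
  shows "pair_graph (local_complement G a)"
proof -
  interpret pair_graph G by fact
  have sub: "parcs (local_complement G a) \<subseteq> pverts G \<times> pverts G"
    by (auto simp: local_complement_def nbhd_def dest: in_arcsD1 in_arcsD2)
  have v: "pverts (local_complement G a) = pverts G"
    by (simp add: local_complement_def)
  have "finite (parcs (local_complement G a))"
    by (rule finite_subset[OF sub]) (simp add: pair_finite_verts)
  moreover have "symmetric (with_proj (local_complement G a))"
    by (auto simp: symmetric_def sym_def local_complement_def dest: arcs_symmetric)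
  moreover have "fst e \<noteq> snd e" if "e \<in> parcs (local_complement G a)" for e
    using that by (auto simp: local_complement_def dest: no_loops')
  ultimately show ?thesis
    using sub v pair_finite_verts by unfold_locales auto
qed

lemma bicolorations_local_inversion:
  assumes "pair_graph G" and "\<beta> \<in> bicolorations G"
  shows "snd (local_inversion (G, \<beta>) a) \<in> bicolorations (fst (local_inversion (G, \<beta>) a))"
proof -
  interpret pair_graph G by fact
  show ?thesis
    using assms(2)
    by (auto simp: bicolorations_def local_inversion_def local_complement_def flip_colors_def
        nbhd_def PiE_iff extensional_def dest: in_arcsD2)
qed

lemma cr_le_iff:
  "cr G \<le> enat N \<longleftrightarrow> (\<forall>\<beta> \<in> bicolorations G. \<exists>w \<in> lists (pverts G).
     length w \<le> N \<and> local_inversions (G, \<beta>) w = color_flip (G, \<beta>) (pverts G))"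
  (is "_ \<longleftrightarrow> ?P N")
proof
  assume "cr G \<le> enat N"
  then have "Inf {enat l | l. ?P l} < enat (Suc N)"
    by (auto simp: cr_def intro: le_less_trans)
  then obtain l where l: "l < Suc N" "?P l"
    unfolding Inf_less_iff by auto
  have "l \<le> N" using l(1) by simp
  with l(2) show "?P N" by (meson order_trans)
next
  assume "?P N"
  then show "cr G \<le> enat N"
    unfolding cr_def by (intro Inf_lower) blast
qed

end

theory Submission
  imports Defs
begin

text \<open>
  The color changes made by a word depend on the graph only, so one word serves all colorings:
  it has to bring the graph back to itself and to flip every vertex an odd number of times. For
  \<open>n \<ge> 3\<close> the proof provides a word of length \<open>3 * n\<close>, which is at most \<open>4 * n - 3\<close>, and at
  most \<open>4 * n - 4\<close> once \<open>n \<ge> 4\<close>.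

  The building block is the word \<open>a b a\<close> for an edge \<open>ab\<close>. On the graph it is the pivot at \<open>ab\<close>,
  and on the colors the flips of its three letters cancel except for a single flip of \<open>a\<close>
  (\<open>takes_pivot\<close>). Pivoting is the principal pivot transform of the adjacency matrix over the
  two-element field, where pivoting on two sets in succession amounts to pivoting on their symmetric
  difference. Hence the pivots at \<open>cu\<close> and then \<open>uv\<close> combine to the pivot at \<open>cv\<close>, and pivoting
  twice at the same edge restores the graph (\<open>pivot_pivot\<close>, \<open>pivot_pivot_cancel\<close>).

  So if \<open>u\<^sub>1, \<dots>, u\<^sub>k\<close> with \<open>k \<ge> 1\<close> are neighbors of \<open>c\<close>, then pivoting at
  \<open>c u\<^sub>1\<close>, \<open>u\<^sub>1 u\<^sub>2\<close>, \<dots>, \<open>u\<^sub>k c\<close> returns to the original graph and flips each of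
  \<open>c, u\<^sub>1, \<dots>, u\<^sub>k\<close> exactly once, at a cost of three letters per vertex (\<open>takes_star\<close>).
  The neighbors may be adjacent to one another. A finite graph without isolated vertices splits into
  disjoint stars of this kind (\<open>star_partitionable_pverts\<close>), and the star words concatenate to the
  word of length \<open>3 * n\<close>. For \<open>n = 2\<close> the bound is 4 and the word \<open>a b\<close> does it.
\<close>

section \<open>The effect of a word\<close>

text \<open>
  The word \<open>w\<close> leads from \<open>G\<close> to \<open>H\<close> and flips exactly the vertices in \<open>A\<close>, whatever the coloring.
\<close>

definition takes :: "'a list \<Rightarrow> 'a pair_pre_digraph \<Rightarrow> 'a set \<Rightarrow> 'a pair_pre_digraph \<Rightarrow> bool" where
  "takes w G A H \<longleftrightarrow> (\<forall>\<beta>. local_inversions (G, \<beta>) w = (H, flip_colors A \<beta>))"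

lemma takes_append:
  assumes "takes v G A H" and "takes w H A' K" and "A \<inter> A' = {}"
  shows "takes (v @ w) G (A \<union> A') K"
proof -
  have "flip_colors A' (flip_colors A \<beta>) = flip_colors (A \<union> A') \<beta>" for \<beta>
    using assms(3) by (auto simp: flip_colors_def fun_eq_iff)
  then show ?thesis
    using assms(1,2) by (simp add: takes_def local_inversions_def)
qed

section \<open>Pivots\<close>

definition pivot :: "'a pair_pre_digraph \<Rightarrow> 'a \<Rightarrow> 'a \<Rightarrow> 'a pair_pre_digraph" where
  "pivot G a b = local_complement (local_complement (local_complement G a) b) a"

lemma arcs_sym: "pair_graph G \<Longrightarrow> (x, y) \<in> parcs G \<longleftrightarrow> (y, x) \<in> parcs G"
  by (meson pair_sym_digraph.arcs_symmetric pair_pseudo_graph_def pair_graph_def)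

lemma arcs_irrefl: "pair_graph G \<Longrightarrow> (x, x) \<notin> parcs G"
  by (meson pair_graph_def pair_digraph_def pair_loopfree_digraph.no_loops')

lemma nbhd_subset_pverts: "pair_graph G \<Longrightarrow> nbhd G v \<subseteq> pverts G"
  by (auto simp: nbhd_def pair_graph_def pair_digraph_def pair_fin_digraph_def
      dest: pair_wf_digraph.arc_snd_in_verts)

lemma pverts_pivot [simp]: "pverts (pivot G a b) = pverts G"
  by (simp add: pivot_def local_complement_def)

lemma pair_graph_pivot: "pair_graph G \<Longrightarrow> pair_graph (pivot G a b)"
  by (simp add: pivot_def pair_graph_local_complement)

text \<open>
  Pivoting at \<open>ab\<close> lets \<open>a\<close> and \<open>b\<close> exchange their neighborhoods and, outside \<open>{a, b}\<close>, adds the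
  alternating form \<open>a\<^sub>x b\<^sub>y + b\<^sub>x a\<^sub>y\<close> in the rows of \<open>a\<close> and \<open>b\<close> to the adjacency matrix modulo 2.
  With this formula, identities between pivots become propositional tautologies in the finitely many
  adjacencies involved.
\<close>

lemma parcs_pivot:
  assumes G: "pair_graph G" and ab: "(a, b) \<in> parcs G"
  shows "(x, y) \<in> parcs (pivot G a b) \<longleftrightarrow>
    (if x \<in> {a, b} \<or> y \<in> {a, b}
     then (transpose a b x, transpose a b y) \<in> parcs G
     else ((x, y) \<in> parcs G) \<noteq>
       ((x \<noteq> y) \<and> (((a, x) \<in> parcs G \<and> (b, y) \<in> parcs G) \<noteq> ((b, x) \<in> parcs G \<and> (a, y) \<in> parcs G))))"
proof -
  note sym = arcs_sym[OF G] and irr = arcs_irrefl[OF G]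
  have "(b, a) \<in> parcs G" "a \<noteq> b" using ab sym irr by auto
  then show ?thesis using ab irr
    by (cases "x = a"; cases "x = b"; cases "y = a"; cases "y = b"; cases "x = y";
      simp add: sym pivot_def local_complement_def nbhd_def; argo)
qed

text \<open>
  Split the other vertices by their adjacency to \<open>a\<close> and \<open>b\<close>. A vertex adjacent to at least one of
  them is hit by exactly two of the three inversions, and \<open>b\<close> is hit by both inversions at \<open>a\<close>; only
  \<open>a\<close> is hit once, by the inversion at \<open>b\<close>.
\<close>

lemma takes_pivot:
  assumes G: "pair_graph G" and ab: "(a, b) \<in> parcs G"
  shows "takes [a, b, a] G {a} (pivot G a b)"
proof -
  note sym = arcs_sym[OF G] and irr = arcs_irrefl[OF G]
  have ba: "(b, a) \<in> parcs G" and "a \<noteq> b" using ab sym irr by auto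
  then show ?thesis using ab irr
    by (auto simp: sym takes_def local_inversions_def local_inversion_def pivot_def flip_colors_def
        fun_eq_iff local_complement_def nbhd_def)
qed

text \<open>
  Here \<open>uv\<close> is an edge after the first pivot because \<open>u\<close> has taken over the neighborhood of \<open>c\<close>,
  so it does not matter whether \<open>u\<close> and \<open>v\<close> are adjacent in \<open>G\<close>.
\<close>

lemma pivot_pivot:
  assumes G: "pair_graph G" and "(c, u) \<in> parcs G" "(c, v) \<in> parcs G" "u \<noteq> v"
  shows "pivot (pivot G c u) u v = pivot G c v"
proof -
  note sym = arcs_sym[OF G] and irr = arcs_irrefl[OF G]
  have neq: "c \<noteq> u" "c \<noteq> v" using assms irr by auto
  have arcs: "(u, c) \<in> parcs G" "(v, c) \<in> parcs G" using assms sym by auto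
  have uv: "(u, v) \<in> parcs (pivot G c u)"
    using assms neq by (simp add: parcs_pivot)
  have "(x, y) \<in> parcs (pivot (pivot G c u) u v) \<longleftrightarrow> (x, y) \<in> parcs (pivot G c v)" for x y
    using assms neq arcs irr
    by (cases "x = c"; cases "x = u"; cases "x = v"; cases "y = c"; cases "y = u"; cases "y = v";
      cases "x = y";
      simp add: sym parcs_pivot[OF pair_graph_pivot[OF G] uv] parcs_pivot[OF G]; argo)
  then show ?thesis by (intro pair_pre_digraph.equality) auto
qed

lemma pivot_pivot_cancel:
  assumes G: "pair_graph G" and "(c, u) \<in> parcs G"
  shows "pivot (pivot G c u) u c = G"
proof -
  note sym = arcs_sym[OF G] and irr = arcs_irrefl[OF G]
  have uc: "(u, c) \<in> parcs (pivot G c u)"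
    using assms by (simp add: parcs_pivot)
  have "(x, y) \<in> parcs (pivot (pivot G c u) u c) \<longleftrightarrow> (x, y) \<in> parcs G" for x y
    using assms irr
    by (cases "x = c"; cases "x = u"; cases "y = c"; cases "y = u"; cases "x = y";
      simp add: sym parcs_pivot[OF pair_graph_pivot[OF G] uc] parcs_pivot[OF G]; argo)
  then show ?thesis by (intro pair_pre_digraph.equality) auto
qed

section \<open>Flipping a star\<close>

text \<open>
  The chain of pivots, stopped before it closes up. After the pivots at \<open>c l\<^sub>1\<close>, \<open>l\<^sub>1 l\<^sub>2\<close>, \<dots>,
  \<open>l\<^sub>k u\<close> the graph is the single pivot of \<open>G\<close> at \<open>cu\<close>, and every visited vertex except the last
  one has been flipped. The end point \<open>u\<close> is arbitrary in the induction, which extends the chain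
  ending in \<open>l\<close> by one pivot at \<open>lu\<close>.
\<close>

lemma takes_star_path:
  assumes G: "pair_graph G" and "finite L" and "L \<subseteq> nbhd G c" and "u \<in> nbhd G c - L"
  shows "\<exists>w \<in> lists (insert c (insert u L)). length w = 3 * (card L + 1) \<and>
    takes w G (insert c L) (pivot G c u)"
  using assms(2-)
proof (induction L arbitrary: u rule: finite_induct)
  case empty
  then have "takes [c, u, c] G {c} (pivot G c u)"
    by (intro takes_pivot[OF G]) (auto simp: nbhd_def)
  then show ?case by (intro bexI[of _ "[c, u, c]"]) auto
next
  case (insert l L)
  then have cl: "(c, l) \<in> parcs G" and cu: "(c, u) \<in> parcs G" and "u \<noteq> l"
    by (auto simp: nbhd_def)
  obtain w where w: "w \<in> lists (insert c (insert l L))" "length w = 3 * (card L + 1)"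
    "takes w G (insert c L) (pivot G c l)"
    using insert.IH[of l] insert.prems insert.hyps by auto
  have neq: "c \<noteq> l" "c \<noteq> u" using cl cu arcs_irrefl[OF G] by auto
  then have "(l, u) \<in> parcs (pivot G c l)"
    using cu \<open>u \<noteq> l\<close> by (simp add: parcs_pivot[OF G cl])
  then have "takes [l, u, l] (pivot G c l) {l} (pivot G c u)"
    using takes_pivot[OF pair_graph_pivot[OF G]] pivot_pivot[OF G cl cu] \<open>u \<noteq> l\<close> by metis
  then have "takes (w @ [l, u, l]) G (insert c L \<union> {l}) (pivot G c u)"
    using neq insert.hyps by (intro takes_append[OF w(3)]) auto
  moreover have "w @ [l, u, l] \<in> lists (insert c (insert u (insert l L)))"
    using w(1) by auto
  moreover have "length (w @ [l, u, l]) = 3 * (card (insert l L) + 1)"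
    using w(2) insert.hyps by simp
  moreover have "insert c L \<union> {l} = insert c (insert l L)" by auto
  ultimately show ?case by metis
qed

text \<open>
  Closing the chain with the pivot at \<open>uc\<close> flips the missing vertex \<open>u\<close> and undoes the accumulated
  pivot at \<open>cu\<close>.
\<close>

lemma takes_star:
  assumes G: "pair_graph G" and "finite L" and "L \<subseteq> nbhd G c" and "L \<noteq> {}"
  shows "\<exists>w \<in> lists (insert c L). length w = 3 * card (insert c L) \<and> takes w G (insert c L) G"
proof -
  obtain u where u: "u \<in> L" using assms(4) by auto
  have c: "c \<notin> L" using assms(3) arcs_irrefl[OF G] by (auto simp: nbhd_def)
  have cu: "(c, u) \<in> parcs G" using u assms(3) by (auto simp: nbhd_def)
  have L: "insert u (L - {u}) = L" using u by auto
  obtain w where w: "w \<in> lists (insert c L)" "length w = 3 * (card (L - {u}) + 1)"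
    "takes w G (insert c (L - {u})) (pivot G c u)"
    using takes_star_path[OF G, of "L - {u}" c u] assms u L by auto
  have "(u, c) \<in> parcs (pivot G c u)"
    using cu by (simp add: parcs_pivot[OF G])
  then have "takes [u, c, u] (pivot G c u) {u} G"
    using takes_pivot[OF pair_graph_pivot[OF G]] pivot_pivot_cancel[OF G cu] by metis
  then have "takes (w @ [u, c, u]) G (insert c (L - {u}) \<union> {u}) G"
    using c u by (intro takes_append[OF w(3)]) auto
  moreover have "insert c (L - {u}) \<union> {u} = insert c L" using u by auto
  moreover have "w @ [u, c, u] \<in> lists (insert c L)" using w(1) u by auto
  moreover have "length (w @ [u, c, u]) = 3 * card (insert c L)"
    using w(2) c u \<open>finite L\<close> card_Suc_Diff1[of L u] by simp
  ultimately show ?thesis by metis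
qed

section \<open>Partition into stars\<close>

text \<open>
  The leaves of a star may be adjacent to one another. Each star has at least one leaf, since a lone
  center admits no pivot.
\<close>

inductive star_partitionable :: "'a pair_pre_digraph \<Rightarrow> 'a set \<Rightarrow> bool" for G where
  empty: "star_partitionable G {}"
| star: "star_partitionable G S \<Longrightarrow> L \<subseteq> nbhd G c \<Longrightarrow> L \<noteq> {} \<Longrightarrow> insert c L \<inter> S = {} \<Longrightarrow>
    star_partitionable G (S \<union> insert c L)"

text \<open>
  If \<open>x\<close> is the center of its star, \<open>v\<close> becomes another leaf. If \<open>x\<close> is the only leaf, the roles of
  center and leaf are exchanged and \<open>v\<close> joins the star now centered at \<open>x\<close>. If \<open>x\<close> is one of several
  leaves, it leaves its star and forms a new one with \<open>v\<close>.
\<close>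

lemma star_partitionable_insert_neighbor:
  assumes G: "pair_graph G" and "star_partitionable G S" and "x \<in> S" "v \<notin> S" and xv: "(x, v) \<in> parcs G"
  shows "star_partitionable G (insert v S)"
  using assms(2-4)
proof induction
  case empty
  then show ?case by simp
next
  case (star S L c)
  consider "x \<in> S" | "x = c" | "x \<in> L" "L = {x}" | "x \<in> L" "L - {x} \<noteq> {}"
    using star.prems by blast
  then show ?case
  proof cases
    case 1
    then have "star_partitionable G (insert v S \<union> insert c L)"
      using star by (intro star_partitionable.star) auto
    then show ?thesis by (simp only: Un_insert_left)
  next
    case 2
    then have "star_partitionable G (S \<union> insert c (insert v L))"
      using star xv by (intro star_partitionable.star) (auto simp: nbhd_def)
    moreover have "S \<union> insert c (insert v L) = insert v (S \<union> insert c L)" by auto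
    ultimately show ?thesis by simp
  next
    case 3
    then have "star_partitionable G (S \<union> insert x {c, v})"
      using star xv arcs_sym[OF G] by (intro star_partitionable.star) (auto simp: nbhd_def)
    moreover have "S \<union> insert x {c, v} = insert v (S \<union> insert c L)" using 3 by auto
    ultimately show ?thesis by simp
  next
    case 4
    have "c \<noteq> x" using 4 star.hyps arcs_irrefl[OF G] by (auto simp: nbhd_def)
    have "star_partitionable G (S \<union> insert c (L - {x}))"
      using 4 star by (intro star_partitionable.star) auto
    then have "star_partitionable G (S \<union> insert c (L - {x}) \<union> insert x {v})"
      using 4 \<open>c \<noteq> x\<close> star xv by (intro star_partitionable.star) (auto simp: nbhd_def)
    moreover have "S \<union> insert c (L - {x}) \<union> insert x {v} = insert v (S \<union> insert c L)"
      using 4 by auto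
    ultimately show ?thesis by simp
  qed
qed

text \<open>
  A maximal union of disjoint stars misses no vertex \<open>v\<close>: a neighbor of \<open>v\<close> is either also missed,
  and then the two form a new star, or it is covered, and then \<open>v\<close> can be inserted next to it.
\<close>

lemma star_partitionable_pverts:
  assumes G: "pair_graph G" and nbr: "\<And>v. v \<in> pverts G \<Longrightarrow> nbhd G v \<noteq> {}"
  shows "star_partitionable G (pverts G)"
proof -
  interpret pair_graph G by fact
  let ?P = "\<lambda>S. S \<subseteq> pverts G \<and> star_partitionable G S"
  have "finite {S. ?P S}" by (rule finite_subset[of _ "Pow (pverts G)"]) auto
  moreover have "{} \<in> {S. ?P S}" by (simp add: star_partitionable.empty)
  ultimately obtain S where S: "?P S" and max: "\<And>T. ?P T \<Longrightarrow> S \<subseteq> T \<Longrightarrow> T = S"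
    using finite_has_maximal[of "{S. ?P S}"] by (metis (mono_tags) empty_iff mem_Collect_eq)
  have "v \<in> S" if v: "v \<in> pverts G" for v
  proof (rule ccontr)
    assume "v \<notin> S"
    obtain x where vx: "(v, x) \<in> parcs G" using nbr[OF v] by (auto simp: nbhd_def)
    then have xv: "(x, v) \<in> parcs G" and x: "x \<in> pverts G"
      using arcs_symmetric in_arcsD2 by auto
    show False
    proof (cases "x \<in> S")
      case True
      then have "?P (insert v S)"
        using S v star_partitionable_insert_neighbor[OF G _ True \<open>v \<notin> S\<close> xv] by auto
      then show False using max \<open>v \<notin> S\<close> by blast
    next
      case False
      then have "?P (S \<union> insert v {x})"
        using S v x vx \<open>v \<notin> S\<close> star_partitionable.star[of G S "{x}" v] by (auto simp: nbhd_def)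
      then show False using max \<open>v \<notin> S\<close> by blast
    qed
  qed
  then show ?thesis using S by (metis subsetI subset_antisym)
qed

lemma takes_star_partitionable:
  assumes G: "pair_graph G" and "star_partitionable G S" and "S \<subseteq> pverts G"
  shows "\<exists>w \<in> lists (pverts G). length w = 3 * card S \<and> takes w G S G"
  using assms(2,3)
proof induction
  case empty
  have "takes [] G {} G" by (simp add: takes_def flip_colors_def)
  then show ?case by force
next
  case (star S L c)
  interpret pair_graph G by fact
  have fin: "finite S" "finite L"
    using star.prems pair_finite_verts by (auto intro: finite_subset)
  obtain v where v: "v \<in> lists (pverts G)" "length v = 3 * card S" "takes v G S G"
    using star by auto
  obtain w where w: "w \<in> lists (insert c L)" "length w = 3 * card (insert c L)"
    "takes w G (insert c L) G"
    using takes_star[OF G fin(2)] star.hyps by metis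
  have "takes (v @ w) G (S \<union> insert c L) G"
    using star.hyps by (intro takes_append[OF v(3) w(3)]) auto
  moreover have "v @ w \<in> lists (pverts G)" using v(1) w(1) star.prems by auto
  moreover have "length (v @ w) = 3 * card (S \<union> insert c L)"
    using v(2) w(2) fin star.hyps by (subst card_Un_disjoint) auto
  ultimately show ?case by blast
qed

section \<open>Bounding the color reversal number\<close>

lemma cr_le_if_takes:
  assumes "w \<in> lists (pverts G)" and "takes w G (pverts G) G" and "length w \<le> N"
  shows "cr G \<le> enat N"
  using assms by (auto simp: cr_le_iff takes_def color_flip_def)

lemma cr_le_3_card:
  assumes "pair_graph G" and "\<And>v. v \<in> pverts G \<Longrightarrow> nbhd G v \<noteq> {}"
  shows "cr G \<le> enat (3 * card (pverts G))"
  using takes_star_partitionable[OF assms(1) star_partitionable_pverts[OF assms]] cr_le_if_takes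
  by fastforce

lemma nbhd_nonempty_if_connected:
  assumes G: "pair_graph G" and con: "Digraph_Component.connected (with_proj G)"
    and card: "card (pverts G) \<ge> 2" and v: "v \<in> pverts G"
  shows "nbhd G v \<noteq> {}"
proof -
  interpret pair_graph G by fact
  have "pverts G \<noteq> {v}" using card by auto
  then obtain u where u: "u \<in> pverts G" "u \<noteq> v" using v by auto
  have "strongly_connected (with_proj G)"
    using symmetric_connected_imp_strongly_connected[OF sym_arcs con] .
  then have "v \<rightarrow>\<^sup>*\<^bsub>with_proj G\<^esub> u" using u v by (simp add: strongly_connected_def)
  then obtain x where "(v, x) \<in> parcs G"
    using u(2) by (cases rule: converse_reachable_cases) simp_all
  then show ?thesis by (auto simp: nbhd_def)
qed

text \<open>
  On a single edge a local inversion leaves the graph unchanged and flips the other end.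
\<close>

lemma cr_edge:
  assumes G: "pair_graph G" and V: "pverts G = {a, b}" and ab: "(a, b) \<in> parcs G"
  shows "cr G \<le> enat 2"
proof (rule cr_le_if_takes)
  have ba: "(b, a) \<in> parcs G" using ab arcs_sym[OF G] by simp
  have "a \<notin> nbhd G a" "b \<notin> nbhd G b" "a \<noteq> b"
    using ab arcs_irrefl[OF G] by (auto simp: nbhd_def)
  moreover have "b \<in> nbhd G a" "a \<in> nbhd G b" using ab ba by (simp_all add: nbhd_def)
  moreover have "nbhd G a \<subseteq> {a, b}" "nbhd G b \<subseteq> {a, b}"
    using nbhd_subset_pverts[OF G] V by auto
  ultimately have nbhd: "nbhd G a = {b}" "nbhd G b = {a}" and "a \<noteq> b"
    by blast+
  have "local_complement G x = G" if "nbhd G x = {y}" for x y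
  proof -
    have "(u \<in> nbhd G x \<and> v \<in> nbhd G x \<and> u \<noteq> v) = False" for u v using that by auto
    then show ?thesis unfolding local_complement_def by simp
  qed
  then have "takes [a] G {b} G" "takes [b] G {a} G"
    using nbhd by (simp_all add: takes_def local_inversions_def local_inversion_def)
  then have "takes ([a] @ [b]) G ({b} \<union> {a}) G"
    using \<open>a \<noteq> b\<close> by (intro takes_append) auto
  then show "takes [a, b] G (pverts G) G"
    using V by (simp add: insert_commute)
qed (use V in auto)

theorem theorem1:
  fixes G :: "'a pair_pre_digraph" and n :: nat
  assumes "pair_graph G"
    and "Digraph_Component.connected (with_proj G)"
    and "n = card (pverts G)"
    and "n \<ge> 2"
  shows "(even n \<longrightarrow> cr G \<le> enat (4 * n - 4)) \<and> (odd n \<longrightarrow> cr G \<le> enat (4 * n - 3))"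
proof -
  have nbr: "nbhd G v \<noteq> {}" if "v \<in> pverts G" for v
    using nbhd_nonempty_if_connected assms that by metis
  have mono: "cr G \<le> enat M" if "cr G \<le> enat N" "N \<le> M" for N M
    using that by (meson enat_ord_simps(1) order_trans)
  show ?thesis
  proof (cases "n = 2")
    case True
    \<comment> \<open>Here \<open>3 * n\<close> exceeds \<open>4 * n - 4\<close>, so the star words are too long.\<close>
    then obtain a b where V: "pverts G = {a, b}"
      using assms(3) by (auto simp: card_2_iff)
    obtain x where "(a, x) \<in> parcs G" using nbr V by (auto simp: nbhd_def)
    moreover have "x \<in> pverts G"
      using nbhd_subset_pverts[OF assms(1)] calculation by (auto simp: nbhd_def)
    ultimately have "cr G \<le> enat 2"
      using cr_edge[OF assms(1) V] V arcs_irrefl[OF assms(1)] by auto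
    then have "cr G \<le> enat (4 * n - 4)" by (rule mono) (simp add: True)
    then show ?thesis using True by simp
  next
    case False
    have le: "cr G \<le> enat (3 * n)" using cr_le_3_card[OF assms(1) nbr] assms(3) by simp
    have "3 * n \<le> 4 * n - 3" "even n \<Longrightarrow> 3 * n \<le> 4 * n - 4"
      using False assms(4) by presburger+
    then show ?thesis using mono[OF le] by simp
  qed
qed

end
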